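(* Consider a refinement chain with $J$ levels, composed either of disjoint subsets (type (D)) or of subsets with fixed scenarios (type (F)). Then the single-cut optimality cut $$\sum_{s\in\mathcal S}p^s(\bm h^s-\bm T^s\bm x)^\top\bm e^s\le\Theta\qquad\forall\,\bm e^s\in\mathcal E(\Lambda^s),\ s\in\mathcal S$$ coincides with the optimality cut at the top level $J$, $$(\bm h_1^{(J)}-\bm T_1^{(J)}\bm x)^\top\bm e\le\theta_1^{(J)}\qquad\forall\,\bm e\in\mathcal E(\Lambda_1^{(J)}),$$ i.e., under the identification $\Theta=\theta_1^{(J)}$ the two families of inequalities are the same.
   Context: Data. $\bm W\in\mathbb R^{p\times m}$; $\mathcal S=\{1,\dots,|\mathcal S|\}$ finite; $\bm T^s\in\mathbb R^{p\times n}$, $\bm h^s\in\mathbb R^p$, $\bm q^s\in\mathbb R^m$ for $s\in\mathcal S$; $\bm x\in\mathbb R^n$ is the first-stage variable and $\Theta,\theta_1^{(J)}\in\mathbb R$. Scenarios $\Omega=\{\bm\omega^1,\dots,\bm\omega^{|\mathcal S|}\}$ with probability measure $\mathbb P$, $p^s=\mathbb P(\bm\omega^s)>0$, $\sum_sp^s=1$. Refinement chain. For each level $j=1,\dots,J$ there is a collection $\{\Omega_i^{(j)}\}_{i=1}^{m_j}$ of nonempty subsets of $\Omega$ covering $\Omega$, with $m_J=1$, $\Omega_1^{(J)}=\Omega$, and for $j\ge2$ each $\Omega_i^{(j)}$ is a union of sets of level $j-1$. Each $\Omega_i^{(j)}$ is the support of a probability measure $\mathbb P_i^{(j)}$ (with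 $\mathbb P_1^{(J)}=\mathbb P$); $\mathbb P=\sum_i\pi_i^{(j)}\mathbb P_i^{(j)}$ is a convex combination at each level, and each $\mathbb P_i^{(j)}$, $j\ge2$, is a convex combination of the measures of the level $j-1$ subsets composing $\Omega_i^{(j)}$. Write $p^s_{\Omega_i^{(j)}}:=\mathbb P_i^{(j)}(\bm\omega^s)$. Type (D): at each level the subsets are pairwise disjoint, $p^s_{\Omega_i^{(j)}}=p^s/\sum_{k:\bm\omega^k\in\Omega_i^{(j)}}p^k$ for $\bm\omega^s\in\Omega_i^{(j)}$, $\pi_i^{(j)}=\sum_{k:\bm\omega^k\in\Omega_i^{(j)}}p^k$. Type (F): for some $f\ge1$ all subsets at all levels contain $F=\{\bm\omega^1,\dots,\bm\omega^f\}$; at each level every non-fixed scenario is in exactly one subset and every subset contains a non-fixed scenario; $p^s_{\Omega_i^{(j)}}=p^s$ for $s\le f$, $p^s_{\Omega_i^{(j)}}=\frac{1-\sum_{k=1}^fp^k}{\sum_{k:\bm\omega^k\in\Omega_i^{(j)}\setminus F}p^k}\,p^s$ for $\bm\omega^s\in\Omega_i^{(j)}\setminus F$, $\pi_i^{(j)}=\frac{\sum_{k:\bm\omega^k\in\Omega_i^{(j)}\setminus F}p^k}{1-\sum_{k=1}^fp^k}$. Dual objects. $\Lambda^s=\{\bm\lambda\in\mathbb R^p:\bm W^\top\bm\lambda\le\bm q^s\}$; $\Lambda_i^{(j)}=\prod_{s:\bm\omega^s\in\Omega_i^{(j)}}\{\bm\lambda^s\in\mathbb R^p:\bm W^\top\bm\lambda^s\le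 p^s_{\Omega_i^{(j)}}\bm q^s\}$; $\bm h_i^{(j)}$, $\bm T_i^{(j)}$ are the stackings of $\bm h^s$, $\bm T^s$ over $s$ with $\bm\omega^s\in\Omega_i^{(j)}$. $\mathcal E(\cdot)$ denotes the set of extreme points. *)

theory Defs
  imports "HOL-Analysis.Analysis" "HOL-Probability.Probability_Mass_Function"
begin

(* The index set S = {1, ..., |S|} is a finite linearly ordered type 's: the order is the
   numbering, and the number of s is card {..s}.  Scenario number s is \<omega> s. *)

definition convex_comb :: "'w pmf \<Rightarrow> 'i set \<Rightarrow> ('i \<Rightarrow> real) \<Rightarrow> ('i \<Rightarrow> 'w pmf) \<Rightarrow> bool" where
  "convex_comb Q I c R \<longleftrightarrow>
     (\<forall>i\<in>I. 0 \<le> c i) \<and> (\<Sum>i\<in>I. c i) = 1 \<and> (\<forall>w. pmf Q w = (\<Sum>i\<in>I. c i * pmf (R i) w))"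

(* m j is the number of subsets at level j; level j consists of the subsets Om j i with
   measures PP j i and weights \<pi> j i, where i ranges over {1..m j}.  The set K below collects
   the level j - 1 subsets composing Om j i. *)
definition refinement_chain ::
  "('s \<Rightarrow> 'w) \<Rightarrow> 'w pmf \<Rightarrow> nat \<Rightarrow> (nat \<Rightarrow> nat) \<Rightarrow> (nat \<Rightarrow> nat \<Rightarrow> 'w set)
     \<Rightarrow> (nat \<Rightarrow> nat \<Rightarrow> 'w pmf) \<Rightarrow> (nat \<Rightarrow> nat \<Rightarrow> real) \<Rightarrow> bool" where
  "refinement_chain \<omega> P J m Om PP \<pi> \<longleftrightarrow>
     1 \<le> J \<and> m J = 1 \<and> Om J 1 = range \<omega> \<and> PP J 1 = P \<and>
     (\<forall>j\<in>{1..J}.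
        (\<forall>i\<in>{1..m j}. Om j i \<noteq> {} \<and> Om j i \<subseteq> range \<omega> \<and> set_pmf (PP j i) = Om j i) \<and>
        (\<Union>i\<in>{1..m j}. Om j i) = range \<omega> \<and>
        convex_comb P {1..m j} (\<pi> j) (PP j)) \<and>
     (\<forall>j\<in>{2..J}. \<forall>i\<in>{1..m j}. \<exists>K \<subseteq> {1..m (j - 1)}.
        Om j i = (\<Union>k\<in>K. Om (j - 1) k) \<and>
        (\<exists>c. convex_comb (PP j i) K c (PP (j - 1))))"

definition type_D ::
  "('s::finite \<Rightarrow> 'w) \<Rightarrow> 'w pmf \<Rightarrow> nat \<Rightarrow> (nat \<Rightarrow> nat) \<Rightarrow> (nat \<Rightarrow> nat \<Rightarrow> 'w set)
     \<Rightarrow> (nat \<Rightarrow> nat \<Rightarrow> 'w pmf) \<Rightarrow> (nat \<Rightarrow> nat \<Rightarrow> real) \<Rightarrow> bool" where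
  "type_D \<omega> P J m Om PP \<pi> \<longleftrightarrow>
     (\<forall>j\<in>{1..J}.
        disjoint_family_on (Om j) {1..m j} \<and>
        (\<forall>i\<in>{1..m j}.
           (\<forall>s. \<omega> s \<in> Om j i \<longrightarrow>
              pmf (PP j i) (\<omega> s) = pmf P (\<omega> s) / (\<Sum>k | \<omega> k \<in> Om j i. pmf P (\<omega> k))) \<and>
           \<pi> j i = (\<Sum>k | \<omega> k \<in> Om j i. pmf P (\<omega> k))))"

definition fixed_scenarios :: "('s::{finite,linorder} \<Rightarrow> 'w) \<Rightarrow> nat \<Rightarrow> 'w set" where
  "fixed_scenarios \<omega> f = \<omega> ` {s. card {..s} \<le> f}"

definition type_F ::
  "('s::{finite,linorder} \<Rightarrow> 'w) \<Rightarrow> 'w pmf \<Rightarrow> nat \<Rightarrow> (nat \<Rightarrow> nat) \<Rightarrow> (nat \<Rightarrow> nat \<Rightarrow> 'w set)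
     \<Rightarrow> (nat \<Rightarrow> nat \<Rightarrow> 'w pmf) \<Rightarrow> (nat \<Rightarrow> nat \<Rightarrow> real) \<Rightarrow> bool" where
  "type_F \<omega> P J m Om PP \<pi> \<longleftrightarrow>
     (\<exists>f\<in>{1..CARD('s)}.
        let F = fixed_scenarios \<omega> f;
            rest = 1 - (\<Sum>k | \<omega> k \<in> F. pmf P (\<omega> k))
        in \<forall>j\<in>{1..J}.
             (\<forall>w \<in> range \<omega> - F. \<exists>!i. i \<in> {1..m j} \<and> w \<in> Om j i) \<and>
             (\<forall>i\<in>{1..m j}.
                F \<subseteq> Om j i \<and> Om j i - F \<noteq> {} \<and>
                (\<forall>s. \<omega> s \<in> F \<longrightarrow> pmf (PP j i) (\<omega> s) = pmf P (\<omega> s)) \<and>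
                (\<forall>s. \<omega> s \<in> Om j i - F \<longrightarrow>
                   pmf (PP j i) (\<omega> s) =
                     rest / (\<Sum>k | \<omega> k \<in> Om j i - F. pmf P (\<omega> k)) * pmf P (\<omega> s)) \<and>
                \<pi> j i = (\<Sum>k | \<omega> k \<in> Om j i - F. pmf P (\<omega> k)) / rest))"

definition extreme_points :: "'a::real_vector set \<Rightarrow> 'a set" where
  "extreme_points C = {e. e extreme_point_of C}"

definition dual_poly :: "real^'m^'p \<Rightarrow> real^'m \<Rightarrow> (real^'p) set" where
  "dual_poly W q = {l. transpose W *v l \<le> q}"

(* Vectors stacked over the scenarios of a subset A are elements of real^('s \<times> 'p) whose blocks
   outside A vanish, i.e. the product of the spaces R^p over A is the corresponding coordinate
   subspace.  For A = range \<omega> no block is forced to vanish. *)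

definition block :: "'s::finite \<Rightarrow> real^('s \<times> 'p::finite) \<Rightarrow> real^'p" where
  "block s v = (\<chi> r. v $ (s, r))"

definition stack_vec :: "('s::finite \<Rightarrow> 'w) \<Rightarrow> 'w set \<Rightarrow> ('s \<Rightarrow> real^'p) \<Rightarrow> real^('s \<times> 'p::finite)" where
  "stack_vec \<omega> A h = (\<chi> c. if \<omega> (fst c) \<in> A then h (fst c) $ snd c else 0)"

definition stack_mat ::
  "('s::finite \<Rightarrow> 'w) \<Rightarrow> 'w set \<Rightarrow> ('s \<Rightarrow> real^'n^'p) \<Rightarrow> real^'n^('s \<times> 'p::finite)" where
  "stack_mat \<omega> A T = (\<chi> c. if \<omega> (fst c) \<in> A then T (fst c) $ snd c else 0)"

definition stacked_dual_poly ::
  "real^'m^'p \<Rightarrow> ('s::finite \<Rightarrow> real^'m) \<Rightarrow> ('s \<Rightarrow> 'w) \<Rightarrow> 'w set \<Rightarrow> 'w pmf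
     \<Rightarrow> (real^('s \<times> 'p::finite)) set" where
  "stacked_dual_poly W q \<omega> A Q =
     {l. (\<forall>s. \<omega> s \<in> A \<longrightarrow> transpose W *v block s l \<le> pmf Q (\<omega> s) *\<^sub>R q s) \<and>
          (\<forall>s. \<omega> s \<notin> A \<longrightarrow> block s l = 0)}"

(* A cut family is a set of inequalities, each one a predicate of the first-stage variable x
   and the recourse variable \<Theta>. *)

definition single_cuts ::
  "real^'m^'p \<Rightarrow> ('s::finite \<Rightarrow> real^'n^'p) \<Rightarrow> ('s \<Rightarrow> real^'p) \<Rightarrow> ('s \<Rightarrow> real^'m)
     \<Rightarrow> ('s \<Rightarrow> 'w) \<Rightarrow> 'w pmf \<Rightarrow> (real^'n \<Rightarrow> real \<Rightarrow> bool) set" where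
  "single_cuts W T h q \<omega> P =
     {\<lambda>x \<Theta>. (\<Sum>s\<in>UNIV. pmf P (\<omega> s) * ((h s - T s *v x) \<bullet> e s)) \<le> \<Theta> | e.
        \<forall>s. e s \<in> extreme_points (dual_poly W (q s))}"

definition subset_cuts ::
  "real^'m^'p \<Rightarrow> ('s::finite \<Rightarrow> real^'n^'p) \<Rightarrow> ('s \<Rightarrow> real^'p) \<Rightarrow> ('s \<Rightarrow> real^'m)
     \<Rightarrow> ('s \<Rightarrow> 'w) \<Rightarrow> 'w set \<Rightarrow> 'w pmf \<Rightarrow> (real^'n \<Rightarrow> real \<Rightarrow> bool) set" where
  "subset_cuts W T h q \<omega> A Q =
     {\<lambda>x \<theta>. (stack_vec \<omega> A h - stack_mat \<omega> A T *v x) \<bullet> e \<le> \<theta> | e.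
        e \<in> extreme_points (stacked_dual_poly W q \<omega> A Q)}"

end

(* The top-level subset is all of \<Omega> with measure P, so its dual polyhedron is the product over
   the scenarios of the dilations p^s \<Lambda>^s.  Extreme points of a product are exactly the products of
   extreme points, and dilation by p^s > 0 maps extreme points to extreme points; hence the extreme
   points of the stacked polyhedron are the stackings of p^s e^s with e^s extreme in \<Lambda>^s, and both
   cuts contain the same inequality for corresponding points. *)

theory Submission
  imports Defs
begin

text \<open>The two-sided inverse of taking all blocks: \<open>stack_vec\<close> without the
  membership test, which is what stacking over the full scenario set amounts to.\<close>

definition unblock :: "('s::finite \<Rightarrow> real^'p) \<Rightarrow> real^('s \<times> 'p::finite)" where
  "unblock e = (\<chi> c. e (fst c) $ snd c)"

lemma block_unblock [simp]: "block s (unblock e) = e s"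
  by (simp add: block_def unblock_def vec_eq_iff)

lemma block_eq_iff: "u = v \<longleftrightarrow> (\<forall>s. block s u = block s v)"
  by (auto simp: block_def vec_eq_iff)

lemma block_add [simp]: "block s (u + v) = block s u + block s v"
  by (simp add: block_def vec_eq_iff)

lemma block_diff [simp]: "block s (u - v) = block s u - block s v"
  by (simp add: block_def vec_eq_iff)

lemma block_scaleR [simp]: "block s (c *\<^sub>R v) = c *\<^sub>R block s v"
  by (simp add: block_def vec_eq_iff)

lemma inner_block: "u \<bullet> v = (\<Sum>s\<in>UNIV. block s u \<bullet> block s v)"
proof -
  have "u \<bullet> v = (\<Sum>c\<in>UNIV \<times> UNIV. u $ c \<bullet> v $ c)"
    by (simp add: inner_vec_def)
  also have "\<dots> = (\<Sum>s\<in>UNIV. \<Sum>r\<in>UNIV. u $ (s, r) \<bullet> v $ (s, r))"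
    by (simp add: sum.cartesian_product)
  finally show ?thesis
    by (simp add: inner_vec_def block_def)
qed

text \<open>A segment in one factor lifts to the product by freezing all other blocks; conversely, a
  proper segment through \<open>e\<close> projects to a proper segment in some block.\<close>

lemma extreme_point_of_product:
  fixes C :: "'s::finite \<Rightarrow> (real^'p) set"
  shows "e extreme_point_of {l. \<forall>s. block s l \<in> C s} \<longleftrightarrow> (\<forall>s. block s e extreme_point_of C s)"
    (is "e extreme_point_of ?C \<longleftrightarrow> ?R")
proof
  assume e: "e extreme_point_of ?C"
  show ?R
  proof
    fix s
    have mem: "block t e \<in> C t" for t
      using e by (simp add: extreme_point_of_def)
    have "block s e \<notin> open_segment a b" if ab: "a \<in> C s" "b \<in> C s" for a b
    proof
      assume "block s e \<in> open_segment a b"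
      then obtain u where u: "a \<noteq> b" "0 < u" "u < 1" "block s e = (1 - u) *\<^sub>R a + u *\<^sub>R b"
        by (auto simp: in_segment)
      \<comment> \<open>Replaces block \<open>s\<close> of \<open>e\<close> by \<open>x\<close>. In
        every other block both endpoints equal that of \<open>e\<close>, and the weights
        \<open>1 - u\<close> and \<open>u\<close> add up to 1.\<close>
      define subst where "subst x = unblock ((\<lambda>t. block t e)(s := x))" for x
      have "subst a \<noteq> subst b"
        using u(1) by (auto simp: subst_def block_eq_iff)
      moreover have "e = (1 - u) *\<^sub>R subst a + u *\<^sub>R subst b"
        using u(4) by (simp add: subst_def block_eq_iff flip: scaleR_left.add)
      ultimately have "e \<in> open_segment (subst a) (subst b)"
        using u(2,3) by (auto simp: in_segment)
      moreover have "subst a \<in> ?C" "subst b \<in> ?C"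
        using ab mem by (auto simp: subst_def)
      ultimately show False
        using e by (auto simp: extreme_point_of_def)
    qed
    then show "block s e extreme_point_of C s"
      using mem by (simp add: extreme_point_of_def)
  qed
next
  assume R: ?R
  have "e \<notin> open_segment a b" if ab: "a \<in> ?C" "b \<in> ?C" for a b
  proof
    assume "e \<in> open_segment a b"
    then obtain u where u: "a \<noteq> b" "0 < u" "u < 1" "e = (1 - u) *\<^sub>R a + u *\<^sub>R b"
      by (auto simp: in_segment)
    \<comment> \<open>The projected segment may collapse to a point in some blocks, so a block
      separating the endpoints is chosen.\<close>
    from u(1) obtain s where "block s a \<noteq> block s b"
      by (auto simp: block_eq_iff)
    with u have "block s e \<in> open_segment (block s a) (block s b)"
      by (auto simp: in_segment)
    with R ab show False
      by (auto simp: extreme_point_of_def)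
  qed
  with R show "e extreme_point_of ?C"
    by (auto simp: extreme_point_of_def)
qed

text \<open>Extreme points are the singleton faces, and an injective linear map preserves and
  reflects faces.\<close>

lemma extreme_point_of_dilation:
  fixes c :: real
  assumes "c \<noteq> 0"
  shows "c *\<^sub>R e extreme_point_of (*\<^sub>R) c ` S \<longleftrightarrow> e extreme_point_of S"
proof -
  have "{c *\<^sub>R e} face_of (*\<^sub>R) c ` S \<longleftrightarrow> {e} face_of S"
    using face_of_linear_image[of "(*\<^sub>R) c" "{e}" S] assms
    by (simp add: bounded_linear.linear[OF bounded_linear_scaleR_right] inj_on_def)
  then show ?thesis
    by (simp add: face_of_singleton)
qed

lemma dual_poly_scaleR:
  assumes "0 < c"
  shows "dual_poly W (c *\<^sub>R q) = (*\<^sub>R) c ` dual_poly W q"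
proof -
  have iff: "l \<in> dual_poly W (c *\<^sub>R q) \<longleftrightarrow> inverse c *\<^sub>R l \<in> dual_poly W q" for l
    \<comment> \<open>Dividing by \<open>c > 0\<close> keeps the direction of the inequality. The
      deleted simp rule would turn \<open>transpose W *v l\<close> into \<open>l v* W\<close>,
      hiding it from \<open>matrix_vector_mult_scaleR\<close>.\<close>
    using assms
    by (simp add: dual_poly_def less_eq_vec_def matrix_vector_mult_scaleR field_simps
        del: transpose_matrix_vector)
  show ?thesis
  proof (intro equalityI subsetI)
    fix l assume "l \<in> dual_poly W (c *\<^sub>R q)"
    then have "c *\<^sub>R (inverse c *\<^sub>R l) \<in> (*\<^sub>R) c ` dual_poly W q"
      unfolding iff by (rule imageI)
    then show "l \<in> (*\<^sub>R) c ` dual_poly W q"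
      using assms by simp
  next
    fix l assume "l \<in> (*\<^sub>R) c ` dual_poly W q"
    then show "l \<in> dual_poly W (c *\<^sub>R q)"
      unfolding iff using assms by auto
  qed
qed

text \<open>Over the full scenario set no block is forced to vanish, so the polyhedron is a product
  of dilated copies of the \<open>dual_poly W (q s)\<close>.\<close>

lemma extreme_points_stacked_dual_poly:
  fixes W :: "real^'m^'p" and q :: "'s::finite \<Rightarrow> real^'m"
  assumes "set_pmf P = range \<omega>"
  shows "extreme_points (stacked_dual_poly W q \<omega> (range \<omega>) P) =
    {unblock (\<lambda>s. pmf P (\<omega> s) *\<^sub>R e s) | e. \<forall>s. e s \<in> extreme_points (dual_poly W (q s))}"
    (is "?L = _")
proof -
  have pos: "0 < pmf P (\<omega> s)" for s
    using assms by (simp add: pmf_positive)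
  have mem_L: "unblock (\<lambda>s. pmf P (\<omega> s) *\<^sub>R e s) \<in> ?L \<longleftrightarrow>
    (\<forall>s. e s \<in> extreme_points (dual_poly W (q s)))" for e
  proof -
    have "stacked_dual_poly W q \<omega> (range \<omega>) P =
        {l. \<forall>s. block s l \<in> (*\<^sub>R) (pmf P (\<omega> s)) ` dual_poly W (q s)}"
      unfolding dual_poly_scaleR[OF pos, symmetric]
      by (simp add: stacked_dual_poly_def dual_poly_def)
    then show ?thesis
      using pos by (simp add: extreme_points_def extreme_point_of_product
          extreme_point_of_dilation less_imp_neq[THEN not_sym])
  qed
  \<comment> \<open>Dividing each block by its positive probability puts any vector in the form
    treated by \<open>mem_L\<close>, so \<open>mem_L\<close> determines all of
    \<open>?L\<close>.\<close>
  have "\<exists>e. v = unblock (\<lambda>s. pmf P (\<omega> s) *\<^sub>R e s)" for v :: "real^('s \<times> 'p)"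
    using pos by (intro exI[of _ "\<lambda>s. inverse (pmf P (\<omega> s)) *\<^sub>R block s v"])
      (simp add: block_eq_iff less_imp_neq[THEN not_sym])
  with mem_L show ?thesis
    by (smt (verit) Collect_cong mem_Collect_eq set_eqI)
qed

text \<open>The inner product splits over blocks, so scaling factors in the dual vector become the
  probability weights of the single cut.\<close>

lemma inner_stack_unblock:
  "(stack_vec \<omega> (range \<omega>) h - stack_mat \<omega> (range \<omega>) T *v x) \<bullet> unblock (\<lambda>s. c s *\<^sub>R e s) =
    (\<Sum>s\<in>UNIV. c s * ((h s - T s *v x) \<bullet> e s))"
proof -
  have "block s (stack_vec \<omega> (range \<omega>) h) = h s" for s
    by (simp add: stack_vec_def block_def vec_eq_iff)
  moreover have "block s (stack_mat \<omega> (range \<omega>) T *v x) = T s *v x" for s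
    by (simp add: stack_mat_def block_def vec_eq_iff matrix_vector_mult_def)
  ultimately show ?thesis
    by (simp add: inner_block)
qed

lemma ball_Collect_ex: "(\<forall>y\<in>{f x | x. A x}. B y) \<longleftrightarrow> (\<forall>x. A x \<longrightarrow> B (f x))"
  by blast

theorem proposition3p5:
  fixes W :: "real^'m^'p"
    and T :: "'s::{finite,linorder} \<Rightarrow> real^'n^'p"
    and h :: "'s \<Rightarrow> real^'p"
    and q :: "'s \<Rightarrow> real^'m"
    and \<omega> :: "'s \<Rightarrow> 'w"
    and P :: "'w pmf"
    and J :: nat
    and m :: "nat \<Rightarrow> nat"
    and Om :: "nat \<Rightarrow> nat \<Rightarrow> 'w set"
    and PP :: "nat \<Rightarrow> nat \<Rightarrow> 'w pmf"
    and \<pi> :: "nat \<Rightarrow> nat \<Rightarrow> real"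
  assumes "inj \<omega>"
    and "set_pmf P = range \<omega>"
    and "refinement_chain \<omega> P J m Om PP \<pi>"
    and "type_D \<omega> P J m Om PP \<pi> \<or> type_F \<omega> P J m Om PP \<pi>"
  shows "single_cuts W T h q \<omega> P = subset_cuts W T h q \<omega> (Om J 1) (PP J 1) \<and>
    (\<forall>x \<Theta> \<theta>. \<Theta> = \<theta> \<longrightarrow>
      ((\<forall>e. (\<forall>s. e s \<in> extreme_points (dual_poly W (q s))) \<longrightarrow>
          (\<Sum>s\<in>UNIV. pmf P (\<omega> s) * ((h s - T s *v x) \<bullet> e s)) \<le> \<Theta>) \<longleftrightarrow>
       (\<forall>e \<in> extreme_points (stacked_dual_poly W q \<omega> (Om J 1) (PP J 1)).
          (stack_vec \<omega> (Om J 1) h - stack_mat \<omega> (Om J 1) T *v x) \<bullet> e \<le> \<theta>)))"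
proof -
  have top: "Om J 1 = range \<omega>" "PP J 1 = P"
    using assms(3) by (auto simp: refinement_chain_def)
  note ext = extreme_points_stacked_dual_poly[OF assms(2), of W q]
  have cuts: "single_cuts W T h q \<omega> P = subset_cuts W T h q \<omega> (range \<omega>) P"
    \<comment> \<open>After these rewrites both families are indexed by the same \<open>e\<close>
      and contain the same stacked inequality.\<close>
    unfolding single_cuts_def subset_cuts_def ext inner_stack_unblock[of \<omega>, symmetric] by blast
  \<comment> \<open>Each quantified system says that every cut of its family holds at the given
    point, so equality of the families yields the equivalence.\<close>
  have "(\<forall>e. (\<forall>s. e s \<in> extreme_points (dual_poly W (q s))) \<longrightarrow>
        (\<Sum>s\<in>UNIV. pmf P (\<omega> s) * ((h s - T s *v x) \<bullet> e s)) \<le> \<Theta>) \<longleftrightarrow>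
      (\<forall>cut \<in> single_cuts W T h q \<omega> P. cut x \<Theta>)" for x \<Theta>
    unfolding single_cuts_def ball_Collect_ex ..
  moreover have "(\<forall>e \<in> extreme_points (stacked_dual_poly W q \<omega> (range \<omega>) P).
        (stack_vec \<omega> (range \<omega>) h - stack_mat \<omega> (range \<omega>) T *v x) \<bullet> e \<le> \<Theta>) \<longleftrightarrow>
      (\<forall>cut \<in> subset_cuts W T h q \<omega> (range \<omega>) P. cut x \<Theta>)" for x \<Theta>
    unfolding subset_cuts_def ball_Collect_ex by (rule Ball_def)
  ultimately show ?thesis
    using cuts unfolding top by simp
qed

end
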